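(* Let $\mathbb{P}$ be a prop and let $\mathcal{C}$ and $\mathcal{D}$ be symmetric monoidal categories. If $\mathcal{C}$ and $\mathcal{D}$ both supply $\mathbb{P}$, then so does their biproduct $\mathcal{C}\oplus\mathcal{D}$.
   Context: Strong monoidal functors between symmetric monoidal categories are always understood to be symmetric; their structure isomorphisms are called strongators. In a symmetric monoidal category $(\mathcal{C},I,\otimes)$, write $b^{\otimes m}$ for the left-bracketed $m$-fold product $((b\otimes b)\otimes\cdots)\otimes b$, with $b^{\otimes 0}=I$ and $b^{\otimes 1}=b$. Write $\sigma\colon c^{\otimes n}\otimes d^{\otimes n}\to(c\otimes d)^{\otimes n}$ and $\sigma\colon I\to I^{\otimes n}$ for the canonical (Mac Lane coherence) isomorphisms, the first one realizing the evident shuffle permutation. A prop is a symmetric strict monoidal category whose monoid of objects is $(\mathbb{N},0,+)$. A supply $s$ of a prop $\mathbb{P}$ in $\mathcal{C}$ consists of a strong monoidal functor $s_c\colon\mathbb{P}\to\mathcal{C}$ for each object $c\in\mathcal{C}$ such that: (i) $s_c(m)=c^{\otimes m}$ for each $m\in\mathbb{N}$; (ii) the strongator $c^{\otimes m}\otimes c^{\otimes n}\to c^{\otimes(m+n)}$ is the unique coherence (rebracketing) isomorphism for each $m,n$; (iii) for all $c,d\in\mathcal{C}$ and $\mu\colon m\to n$ in $\mathbb{P}$, $s_{c\otimes d}(\mu)\circ\sigma=\sigma\circ(s_c(\mu)\otimes s_d(\mu))$ as maps $c^{\otimes m}\otimes d^{\otimes m}\to(c\otimes d)^{\otimes n}$,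 and $s_I(\mu)\circ\sigma=\sigma$ as maps $I\to I^{\otimes n}$. One says $\mathcal{C}$ supplies $\mathbb{P}$ if there is a supply of $\mathbb{P}$ in $\mathcal{C}$. The biproduct $\mathcal{C}\oplus\mathcal{D}$ is the product category $\mathcal{C}\times\mathcal{D}$ with componentwise symmetric monoidal structure: unit $(I,I)$, product $(c_1,d_1)\otimes(c_2,d_2)=(c_1\otimes c_2,d_1\otimes d_2)$, and componentwise associators, unitors, and braiding. *)

theory Defs
  imports Main
begin

section \<open>Categories\<close>

record ('o, 'a) cat =
  Obj :: "'o set"
  Arr :: "'a set"
  Dom :: "'a \<Rightarrow> 'o"
  Cod :: "'a \<Rightarrow> 'o"
  Ident :: "'o \<Rightarrow> 'a"  (\<open>\<one>\<index>\<close>)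
  Comp :: "'a \<Rightarrow> 'a \<Rightarrow> 'a"  (infixl \<open>\<odot>\<index>\<close> 60)

text \<open>Composition is in applicative order: \<open>g \<odot>\<^bsub>C\<^esub> f\<close> is ``first \<open>f\<close>, then \<open>g\<close>''.
  All operations are only constrained on \<^const>\<open>Obj\<close> and \<^const>\<open>Arr\<close>.\<close>

definition hom :: "('o, 'a, 'x) cat_scheme \<Rightarrow> 'o \<Rightarrow> 'o \<Rightarrow> 'a set" where
  "hom C x y = {f \<in> Arr C. Dom C f = x \<and> Cod C f = y}"

definition inverse_arrows :: "('o, 'a, 'x) cat_scheme \<Rightarrow> 'a \<Rightarrow> 'a \<Rightarrow> bool" where
  "inverse_arrows C f g \<longleftrightarrow>
     f \<in> Arr C \<and> g \<in> hom C (Cod C f) (Dom C f) \<and>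
     g \<odot>\<^bsub>C\<^esub> f = \<one>\<^bsub>C\<^esub> (Dom C f) \<and> f \<odot>\<^bsub>C\<^esub> g = \<one>\<^bsub>C\<^esub> (Cod C f)"

definition isos :: "('o, 'a, 'x) cat_scheme \<Rightarrow> 'o \<Rightarrow> 'o \<Rightarrow> 'a set" where
  "isos C x y = {f \<in> hom C x y. \<exists>g. inverse_arrows C f g}"

locale category =
  fixes C :: "('o, 'a, 'x) cat_scheme" (structure)
  assumes dom_obj: "f \<in> Arr C \<Longrightarrow> Dom C f \<in> Obj C"
    and cod_obj: "f \<in> Arr C \<Longrightarrow> Cod C f \<in> Obj C"
    and id_hom: "x \<in> Obj C \<Longrightarrow> \<one> x \<in> hom C x x"
    and comp_hom: "\<lbrakk>f \<in> hom C x y; g \<in> hom C y z\<rbrakk> \<Longrightarrow> g \<odot> f \<in> hom C x z"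
    and id_left: "f \<in> hom C x y \<Longrightarrow> \<one> y \<odot> f = f"
    and id_right: "f \<in> hom C x y \<Longrightarrow> f \<odot> \<one> x = f"
    and comp_assoc: "\<lbrakk>f \<in> hom C w x; g \<in> hom C x y; h \<in> hom C y z\<rbrakk> \<Longrightarrow>
      h \<odot> (g \<odot> f) = (h \<odot> g) \<odot> f"


section \<open>Symmetric monoidal categories\<close>

record ('o, 'a) smcat = "('o, 'a) cat" +
  Unit :: "'o"  (\<open>\<I>\<index>\<close>)
  Tens :: "'o \<Rightarrow> 'o \<Rightarrow> 'o"  (infixl \<open>\<otimes>\<index>\<close> 70)
  TensA :: "'a \<Rightarrow> 'a \<Rightarrow> 'a"  (infixl \<open>\<boxtimes>\<index>\<close> 70)
  Assoc :: "'o \<Rightarrow> 'o \<Rightarrow> 'o \<Rightarrow> 'a"  (\<open>\<alpha>\<index>\<close>)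
  LUnit :: "'o \<Rightarrow> 'a"  (\<open>\<ll>\<index>\<close>)
  RUnit :: "'o \<Rightarrow> 'a"  (\<open>\<rr>\<index>\<close>)
  Braid :: "'o \<Rightarrow> 'o \<Rightarrow> 'a"  (\<open>\<beta>\<index>\<close>)

locale symmetric_monoidal_category = category C
  for C :: "('o, 'a, 'x) smcat_scheme" (structure) +
  assumes unit_obj: "\<I> \<in> Obj C"
    and tens_obj: "\<lbrakk>x \<in> Obj C; y \<in> Obj C\<rbrakk> \<Longrightarrow> x \<otimes> y \<in> Obj C"
    and tens_hom: "\<lbrakk>f \<in> hom C x y; f' \<in> hom C x' y'\<rbrakk> \<Longrightarrow> f \<boxtimes> f' \<in> hom C (x \<otimes> x') (y \<otimes> y')"
    and tens_id: "\<lbrakk>x \<in> Obj C; y \<in> Obj C\<rbrakk> \<Longrightarrow> \<one> x \<boxtimes> \<one> y = \<one> (x \<otimes> y)"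
    and tens_comp: "\<lbrakk>f \<in> hom C x y; g \<in> hom C y z; f' \<in> hom C x' y'; g' \<in> hom C y' z'\<rbrakk> \<Longrightarrow>
      (g \<odot> f) \<boxtimes> (g' \<odot> f') = (g \<boxtimes> g') \<odot> (f \<boxtimes> f')"
    and assoc_iso: "\<lbrakk>x \<in> Obj C; y \<in> Obj C; z \<in> Obj C\<rbrakk> \<Longrightarrow>
      \<alpha> x y z \<in> isos C ((x \<otimes> y) \<otimes> z) (x \<otimes> (y \<otimes> z))"
    and lunit_iso: "x \<in> Obj C \<Longrightarrow> \<ll> x \<in> isos C (\<I> \<otimes> x) x"
    and runit_iso: "x \<in> Obj C \<Longrightarrow> \<rr> x \<in> isos C (x \<otimes> \<I>) x"
    and braid_iso: "\<lbrakk>x \<in> Obj C; y \<in> Obj C\<rbrakk> \<Longrightarrow> \<beta> x y \<in> isos C (x \<otimes> y) (y \<otimes> x)"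
    and assoc_natural: "\<lbrakk>f \<in> hom C x x'; g \<in> hom C y y'; h \<in> hom C z z'\<rbrakk> \<Longrightarrow>
      \<alpha> x' y' z' \<odot> ((f \<boxtimes> g) \<boxtimes> h) = (f \<boxtimes> (g \<boxtimes> h)) \<odot> \<alpha> x y z"
    and lunit_natural: "f \<in> hom C x y \<Longrightarrow> \<ll> y \<odot> (\<one> \<I> \<boxtimes> f) = f \<odot> \<ll> x"
    and runit_natural: "f \<in> hom C x y \<Longrightarrow> \<rr> y \<odot> (f \<boxtimes> \<one> \<I>) = f \<odot> \<rr> x"
    and braid_natural: "\<lbrakk>f \<in> hom C x x'; g \<in> hom C y y'\<rbrakk> \<Longrightarrow>
      \<beta> x' y' \<odot> (f \<boxtimes> g) = (g \<boxtimes> f) \<odot> \<beta> x y"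
    and pentagon: "\<lbrakk>w \<in> Obj C; x \<in> Obj C; y \<in> Obj C; z \<in> Obj C\<rbrakk> \<Longrightarrow>
      \<alpha> w x (y \<otimes> z) \<odot> \<alpha> (w \<otimes> x) y z =
      (\<one> w \<boxtimes> \<alpha> x y z) \<odot> \<alpha> w (x \<otimes> y) z \<odot> (\<alpha> w x y \<boxtimes> \<one> z)"
    and triangle: "\<lbrakk>x \<in> Obj C; y \<in> Obj C\<rbrakk> \<Longrightarrow>
      (\<one> x \<boxtimes> \<ll> y) \<odot> \<alpha> x \<I> y = \<rr> x \<boxtimes> \<one> y"
    and hexagon: "\<lbrakk>x \<in> Obj C; y \<in> Obj C; z \<in> Obj C\<rbrakk> \<Longrightarrow>
      \<alpha> y z x \<odot> \<beta> x (y \<otimes> z) \<odot> \<alpha> x y z =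
      (\<one> y \<boxtimes> \<beta> x z) \<odot> \<alpha> y x z \<odot> (\<beta> x y \<boxtimes> \<one> z)"
    and symmetry: "\<lbrakk>x \<in> Obj C; y \<in> Obj C\<rbrakk> \<Longrightarrow> \<beta> y x \<odot> \<beta> x y = \<one> (x \<otimes> y)"

locale prop_category = symmetric_monoidal_category P
  for P :: "(nat, 'p, 'x) smcat_scheme" (structure) +
  assumes objects: "Obj P = UNIV"
    and unit_zero: "\<I> = 0"
    and tens_add: "m \<otimes> n = m + n"
    and assoc_strict: "\<alpha> k m n = \<one> (k + m + n)"
    and lunit_strict: "\<ll> n = \<one> n"
    and runit_strict: "\<rr> n = \<one> n"

definition biproduct ::
    "('o1, 'a1, 'x) smcat_scheme \<Rightarrow> ('o2, 'a2, 'y) smcat_scheme \<Rightarrow>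
     ('o1 \<times> 'o2, 'a1 \<times> 'a2) smcat"  (infixr \<open>\<oplus>\<close> 65) where
  "C \<oplus> D = \<lparr>
     Obj = Obj C \<times> Obj D,
     Arr = Arr C \<times> Arr D,
     Dom = map_prod (Dom C) (Dom D),
     Cod = map_prod (Cod C) (Cod D),
     Ident = map_prod (Ident C) (Ident D),
     Comp = (\<lambda>(g1, g2) (f1, f2). (g1 \<odot>\<^bsub>C\<^esub> f1, g2 \<odot>\<^bsub>D\<^esub> f2)),
     Unit = (\<I>\<^bsub>C\<^esub>, \<I>\<^bsub>D\<^esub>),
     Tens = (\<lambda>(x1, x2) (y1, y2). (x1 \<otimes>\<^bsub>C\<^esub> y1, x2 \<otimes>\<^bsub>D\<^esub> y2)),
     TensA = (\<lambda>(f1, f2) (g1, g2). (f1 \<boxtimes>\<^bsub>C\<^esub> g1, f2 \<boxtimes>\<^bsub>D\<^esub> g2)),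
     Assoc = (\<lambda>(x1, x2) (y1, y2) (z1, z2). (\<alpha>\<^bsub>C\<^esub> x1 y1 z1, \<alpha>\<^bsub>D\<^esub> x2 y2 z2)),
     LUnit = map_prod (LUnit C) (LUnit D),
     RUnit = map_prod (RUnit C) (RUnit D),
     Braid = (\<lambda>(x1, x2) (y1, y2). (\<beta>\<^bsub>C\<^esub> x1 y1, \<beta>\<^bsub>D\<^esub> x2 y2)) \<rparr>"


section \<open>Strong (symmetric) monoidal functors\<close>

record ('o1, 'a1, 'o2, 'a2) smfunctor =
  FObj :: "'o1 \<Rightarrow> 'o2"
  FArr :: "'a1 \<Rightarrow> 'a2"
  Strongator :: "'o1 \<Rightarrow> 'o1 \<Rightarrow> 'a2"
  UnitStrongator :: "'a2"

locale strong_monoidal_functor =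
  C: symmetric_monoidal_category C + D: symmetric_monoidal_category D
  for C :: "('o1, 'a1, 'x) smcat_scheme" and D :: "('o2, 'a2, 'y) smcat_scheme"
    and F :: "('o1, 'a1, 'o2, 'a2) smfunctor" +
  assumes map_obj: "x \<in> Obj C \<Longrightarrow> FObj F x \<in> Obj D"
    and map_hom: "f \<in> hom C x y \<Longrightarrow> FArr F f \<in> hom D (FObj F x) (FObj F y)"
    and map_id: "x \<in> Obj C \<Longrightarrow> FArr F (\<one>\<^bsub>C\<^esub> x) = \<one>\<^bsub>D\<^esub> (FObj F x)"
    and map_comp: "\<lbrakk>f \<in> hom C x y; g \<in> hom C y z\<rbrakk> \<Longrightarrow>
      FArr F (g \<odot>\<^bsub>C\<^esub> f) = FArr F g \<odot>\<^bsub>D\<^esub> FArr F f"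
    and strongator_iso: "\<lbrakk>x \<in> Obj C; y \<in> Obj C\<rbrakk> \<Longrightarrow>
      Strongator F x y \<in> isos D (FObj F x \<otimes>\<^bsub>D\<^esub> FObj F y) (FObj F (x \<otimes>\<^bsub>C\<^esub> y))"
    and unit_strongator_iso: "UnitStrongator F \<in> isos D \<I>\<^bsub>D\<^esub> (FObj F \<I>\<^bsub>C\<^esub>)"
    and strongator_natural: "\<lbrakk>f \<in> hom C x x'; g \<in> hom C y y'\<rbrakk> \<Longrightarrow>
      Strongator F x' y' \<odot>\<^bsub>D\<^esub> (FArr F f \<boxtimes>\<^bsub>D\<^esub> FArr F g) =
      FArr F (f \<boxtimes>\<^bsub>C\<^esub> g) \<odot>\<^bsub>D\<^esub> Strongator F x y"
    and strongator_assoc: "\<lbrakk>x \<in> Obj C; y \<in> Obj C; z \<in> Obj C\<rbrakk> \<Longrightarrow>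
      FArr F (\<alpha>\<^bsub>C\<^esub> x y z) \<odot>\<^bsub>D\<^esub> Strongator F (x \<otimes>\<^bsub>C\<^esub> y) z
        \<odot>\<^bsub>D\<^esub> (Strongator F x y \<boxtimes>\<^bsub>D\<^esub> \<one>\<^bsub>D\<^esub> (FObj F z)) =
      Strongator F x (y \<otimes>\<^bsub>C\<^esub> z) \<odot>\<^bsub>D\<^esub> (\<one>\<^bsub>D\<^esub> (FObj F x) \<boxtimes>\<^bsub>D\<^esub> Strongator F y z)
        \<odot>\<^bsub>D\<^esub> \<alpha>\<^bsub>D\<^esub> (FObj F x) (FObj F y) (FObj F z)"
    and strongator_lunit: "x \<in> Obj C \<Longrightarrow>
      FArr F (\<ll>\<^bsub>C\<^esub> x) \<odot>\<^bsub>D\<^esub> Strongator F \<I>\<^bsub>C\<^esub> x \<odot>\<^bsub>D\<^esub> (UnitStrongator F \<boxtimes>\<^bsub>D\<^esub> \<one>\<^bsub>D\<^esub> (FObj F x)) =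
      \<ll>\<^bsub>D\<^esub> (FObj F x)"
    and strongator_runit: "x \<in> Obj C \<Longrightarrow>
      FArr F (\<rr>\<^bsub>C\<^esub> x) \<odot>\<^bsub>D\<^esub> Strongator F x \<I>\<^bsub>C\<^esub> \<odot>\<^bsub>D\<^esub> (\<one>\<^bsub>D\<^esub> (FObj F x) \<boxtimes>\<^bsub>D\<^esub> UnitStrongator F) =
      \<rr>\<^bsub>D\<^esub> (FObj F x)"
    and strongator_braid: "\<lbrakk>x \<in> Obj C; y \<in> Obj C\<rbrakk> \<Longrightarrow>
      FArr F (\<beta>\<^bsub>C\<^esub> x y) \<odot>\<^bsub>D\<^esub> Strongator F x y =
      Strongator F y x \<odot>\<^bsub>D\<^esub> \<beta>\<^bsub>D\<^esub> (FObj F x) (FObj F y)"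


section \<open>Tensor powers and coherence isomorphisms\<close>

text \<open>\<open>lprod e t f n\<close> is the left-bracketed product \<open>((f 0 \<cdot> f 1) \<cdot> \<dots>) \<cdot> f (n - 1)\<close> for the
  binary operation \<open>t\<close>; it is \<open>e\<close> for \<open>n = 0\<close> and \<open>f 0\<close> (not \<open>t e (f 0)\<close>) for \<open>n = 1\<close>.\<close>

fun lprod :: "'w \<Rightarrow> ('w \<Rightarrow> 'w \<Rightarrow> 'w) \<Rightarrow> (nat \<Rightarrow> 'w) \<Rightarrow> nat \<Rightarrow> 'w" where
  "lprod e t f 0 = e"
| "lprod e t f (Suc 0) = f 0"
| "lprod e t f (Suc (Suc n)) = t (lprod e t f (Suc n)) (f (Suc n))"

definition tpow :: "('o, 'a, 'x) smcat_scheme \<Rightarrow> 'o \<Rightarrow> nat \<Rightarrow> 'o" where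
  "tpow C c n = lprod \<I>\<^bsub>C\<^esub> (Tens C) (\<lambda>_. c) n"

datatype 'v word = WUnit | Var 'v | WTens "'v word" "'v word"

primrec weval :: "('o, 'a, 'x) smcat_scheme \<Rightarrow> ('v \<Rightarrow> 'o) \<Rightarrow> 'v word \<Rightarrow> 'o" where
  "weval C \<theta> WUnit = \<I>\<^bsub>C\<^esub>"
| "weval C \<theta> (Var v) = \<theta> v"
| "weval C \<theta> (WTens u w) = weval C \<theta> u \<otimes>\<^bsub>C\<^esub> weval C \<theta> w"

text \<open>\<open>coherence_iso C \<theta> u w f\<close>: the arrow \<open>f\<close> is the value in \<open>C\<close>, under the assignment \<open>\<theta>\<close>, of a
  formal composite from the word \<open>u\<close> to the word \<open>w\<close> of identities, associators, unitors,
  braidings, their tensor products and their inverses.  The formal composite, and with it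
  the permutation it realizes, is tracked at the level of words, where \<open>\<theta>\<close> may identify variables.
  If every variable occurs at most once in \<open>u\<close>, then the words \<open>u\<close> and \<open>w\<close> determine
  the permutation, and Mac Lane's coherence theorem says that \<open>f\<close> is unique.\<close>

inductive coherence_iso ::
    "('o, 'a, 'x) smcat_scheme \<Rightarrow> ('v \<Rightarrow> 'o) \<Rightarrow> 'v word \<Rightarrow> 'v word \<Rightarrow> 'a \<Rightarrow> bool"
  for C :: "('o, 'a, 'x) smcat_scheme" (structure) and \<theta> :: "'v \<Rightarrow> 'o" where
  ident: "coherence_iso C \<theta> u u (\<one> (weval C \<theta> u))"
| assoc: "coherence_iso C \<theta> (WTens (WTens u v) w) (WTens u (WTens v w))
    (\<alpha> (weval C \<theta> u) (weval C \<theta> v) (weval C \<theta> w))"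
| lunit: "coherence_iso C \<theta> (WTens WUnit u) u (\<ll> (weval C \<theta> u))"
| runit: "coherence_iso C \<theta> (WTens u WUnit) u (\<rr> (weval C \<theta> u))"
| braid: "coherence_iso C \<theta> (WTens u v) (WTens v u) (\<beta> (weval C \<theta> u) (weval C \<theta> v))"
| comp: "\<lbrakk>coherence_iso C \<theta> u v f; coherence_iso C \<theta> v w g\<rbrakk> \<Longrightarrow> coherence_iso C \<theta> u w (g \<odot> f)"
| tens: "\<lbrakk>coherence_iso C \<theta> u v f; coherence_iso C \<theta> u' v' f'\<rbrakk> \<Longrightarrow>
    coherence_iso C \<theta> (WTens u u') (WTens v v') (f \<boxtimes> f')"
| inv: "\<lbrakk>coherence_iso C \<theta> u v f; inverse_arrows C f g\<rbrakk> \<Longrightarrow> coherence_iso C \<theta> v u g"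

abbreviation wprod :: "(nat \<Rightarrow> 'v word) \<Rightarrow> nat \<Rightarrow> 'v word" where
  "wprod \<equiv> lprod WUnit WTens"

text \<open>The coherence isomorphisms \<open>c\<^sup>m \<otimes> c\<^sup>n \<rightarrow> c\<^sup>m\<^sup>+\<^sup>n\<close> (preserving the order of the factors),
  \<open>c\<^sup>n \<otimes> d\<^sup>n \<rightarrow> (c \<otimes> d)\<^sup>n\<close> (sending the \<open>i\<close>-th \<open>c\<close> and the \<open>i\<close>-th \<open>d\<close> to the \<open>i\<close>-th \<open>c \<otimes> d\<close>) and
  \<open>I \<rightarrow> I\<^sup>n\<close>.  The factors carry pairwise distinct variables, so that each
  predicate singles out one arrow.\<close>

definition rebracketing :: "('o, 'a, 'x) smcat_scheme \<Rightarrow> 'o \<Rightarrow> nat \<Rightarrow> nat \<Rightarrow> 'a \<Rightarrow> bool" where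
  "rebracketing C c m n f \<longleftrightarrow>
     coherence_iso C (\<lambda>_ :: nat. c)
       (WTens (wprod Var m) (wprod (\<lambda>i. Var (m + i)) n)) (wprod Var (m + n)) f"

definition shuffle :: "('o, 'a, 'x) smcat_scheme \<Rightarrow> 'o \<Rightarrow> 'o \<Rightarrow> nat \<Rightarrow> 'a \<Rightarrow> bool" where
  "shuffle C c d n f \<longleftrightarrow>
     coherence_iso C (case_sum (\<lambda>_ :: nat. c) (\<lambda>_ :: nat. d))
       (WTens (wprod (\<lambda>i. Var (Inl i)) n) (wprod (\<lambda>i. Var (Inr i)) n))
       (wprod (\<lambda>i. WTens (Var (Inl i)) (Var (Inr i))) n) f"

definition unit_shuffle :: "('o, 'a, 'x) smcat_scheme \<Rightarrow> nat \<Rightarrow> 'a \<Rightarrow> bool" where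
  "unit_shuffle C n f \<longleftrightarrow>
     coherence_iso C (\<lambda>_ :: unit. \<I>\<^bsub>C\<^esub>) WUnit (wprod (\<lambda>_. WUnit) n) f"

text \<open>The three predicates are inhabited and their arrows have the intended (co)domains.\<close>

lemma weval_wprod: "weval C \<theta> (wprod g n) = lprod \<I>\<^bsub>C\<^esub> (Tens C) (\<lambda>i. weval C \<theta> (g i)) n"
  by (induction n rule: induct_nat_012) simp_all

context symmetric_monoidal_category
begin

lemma weval_obj:
  assumes "\<And>v. \<theta> v \<in> Obj C"
  shows "weval C \<theta> u \<in> Obj C"
  by (induction u) (simp_all add: assms unit_obj tens_obj)

lemma coherence_iso_hom:
  assumes \<theta>: "\<And>v. \<theta> v \<in> Obj C" and "coherence_iso C \<theta> u w f"
  shows "f \<in> hom C (weval C \<theta> u) (weval C \<theta> w)"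
  using assms(2)
proof (induction rule: coherence_iso.induct)
  case (comp u v f w g)
  then show ?case by (blast intro: comp_hom)
next
  case (inv u v f g)
  then show ?case by (auto simp: inverse_arrows_def hom_def)
qed (use assoc_iso lunit_iso runit_iso braid_iso in
      \<open>simp_all add: weval_obj[of \<theta>, OF \<theta>] id_hom tens_hom isos_def\<close>)

lemma rebracketing_hom:
  "\<lbrakk>c \<in> Obj C; rebracketing C c m n f\<rbrakk> \<Longrightarrow> f \<in> hom C (tpow C c m \<otimes> tpow C c n) (tpow C c (m + n))"
  unfolding rebracketing_def
  by (drule coherence_iso_hom[rotated]) (simp_all add: weval_wprod tpow_def)

lemma shuffle_hom:
  "\<lbrakk>c \<in> Obj C; d \<in> Obj C; shuffle C c d n f\<rbrakk> \<Longrightarrow>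
     f \<in> hom C (tpow C c n \<otimes> tpow C d n) (tpow C (c \<otimes> d) n)"
  unfolding shuffle_def
  by (drule coherence_iso_hom[rotated]) (simp_all add: weval_wprod tpow_def split: sum.split)

lemma unit_shuffle_hom: "unit_shuffle C n f \<Longrightarrow> f \<in> hom C \<I> (tpow C \<I> n)"
  unfolding unit_shuffle_def
  by (drule coherence_iso_hom[rotated]) (simp_all add: weval_wprod tpow_def unit_obj)

definition coherent :: "('v \<Rightarrow> 'o) \<Rightarrow> 'v word \<Rightarrow> 'v word \<Rightarrow> bool" where
  "coherent \<theta> u w \<longleftrightarrow> (\<exists>f. coherence_iso C \<theta> u w f)"

lemma coherent_refl: "coherent \<theta> u u"
  unfolding coherent_def by (rule exI, rule coherence_iso.ident)

lemma coherent_trans: "\<lbrakk>coherent \<theta> u v; coherent \<theta> v w\<rbrakk> \<Longrightarrow> coherent \<theta> u w"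
  unfolding coherent_def by (elim exE, rule exI, rule coherence_iso.comp)

lemma coherent_tens:
  "\<lbrakk>coherent \<theta> u v; coherent \<theta> u' v'\<rbrakk> \<Longrightarrow> coherent \<theta> (WTens u u') (WTens v v')"
  unfolding coherent_def by (elim exE, rule exI, rule coherence_iso.tens)

lemma coherent_assoc: "coherent \<theta> (WTens (WTens u v) w) (WTens u (WTens v w))"
  unfolding coherent_def by (rule exI, rule coherence_iso.assoc)

lemma coherent_lunit: "coherent \<theta> (WTens WUnit u) u"
  unfolding coherent_def by (rule exI, rule coherence_iso.lunit)

lemma coherent_runit: "coherent \<theta> (WTens u WUnit) u"
  unfolding coherent_def by (rule exI, rule coherence_iso.runit)

lemma coherent_braid: "coherent \<theta> (WTens u v) (WTens v u)"
  unfolding coherent_def by (rule exI, rule coherence_iso.braid)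

lemma coherent_assoc_inv:
  assumes "\<And>v. \<theta> v \<in> Obj C"
  shows "coherent \<theta> (WTens u (WTens v w)) (WTens (WTens u v) w)"
proof -
  note wo = weval_obj[of \<theta>, OF assms]
  obtain g where "inverse_arrows C (\<alpha> (weval C \<theta> u) (weval C \<theta> v) (weval C \<theta> w)) g"
    using assoc_iso[OF wo[of u] wo[of v] wo[of w]] by (auto simp: isos_def)
  then show ?thesis
    unfolding coherent_def by (intro exI) (rule coherence_iso.inv[OF coherence_iso.assoc])
qed

lemma coherent_runit_inv:
  assumes "\<And>v. \<theta> v \<in> Obj C"
  shows "coherent \<theta> u (WTens u WUnit)"
proof -
  obtain g where "inverse_arrows C (\<rr> (weval C \<theta> u)) g"
    using runit_iso[OF weval_obj[of \<theta> u, OF assms]] by (auto simp: isos_def)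
  then show ?thesis
    unfolding coherent_def by (intro exI) (rule coherence_iso.inv[OF coherence_iso.runit])
qed

lemma rebracketing_exists:
  assumes c: "c \<in> Obj C"
  shows "\<exists>f. rebracketing C c m n f"
proof -
  have "coherent (\<lambda>_. c) (WTens (wprod Var m) (wprod (\<lambda>i. Var (m + i)) n)) (wprod Var (m + n))"
  proof (cases m)
    case 0
    then show ?thesis by (simp add: coherent_lunit)
  next
    case (Suc k)
    show ?thesis
    proof (induction n rule: induct_nat_012)
      case 0
      show ?case by (simp add: coherent_runit)
    next
      case 1
      show ?case by (simp add: Suc coherent_refl)
    next
      case (ge2 n)
      from coherent_trans[OF coherent_assoc_inv coherent_tens[OF ge2(2) coherent_refl]] c
      show ?case by (simp add: Suc)
    qed
  qed
  then show ?thesis by (simp add: rebracketing_def coherent_def)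
qed

lemma shuffle_exists:
  assumes c: "c \<in> Obj C" and d: "d \<in> Obj C"
  shows "\<exists>f. shuffle C c d n f"
proof -
  let ?\<theta> = "case_sum (\<lambda>_ :: nat. c) (\<lambda>_ :: nat. d)"
  have \<theta>: "?\<theta> v \<in> Obj C" for v
    using c d by (cases v) auto
  note asi = coherent_assoc_inv[of ?\<theta>, OF \<theta>]
  have swap: "coherent ?\<theta> (WTens a (WTens v b)) (WTens v (WTens a b))" for a b v
    by (rule coherent_trans[OF asi
          coherent_trans[OF coherent_tens[OF coherent_braid coherent_refl] coherent_assoc]])
  have mid: "coherent ?\<theta> (WTens (WTens u a) (WTens v b)) (WTens (WTens u v) (WTens a b))"
    for u a v b
    by (rule coherent_trans[OF coherent_assoc
          coherent_trans[OF coherent_tens[OF coherent_refl swap] asi]])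
  have "coherent ?\<theta>
      (WTens (wprod (\<lambda>i. Var (Inl i)) n) (wprod (\<lambda>i. Var (Inr i)) n))
      (wprod (\<lambda>i. WTens (Var (Inl i)) (Var (Inr i))) n)"
  proof (induction n rule: induct_nat_012)
    case 0
    show ?case by (simp add: coherent_lunit)
  next
    case 1
    show ?case by (simp add: coherent_refl)
  next
    case (ge2 n)
    from coherent_trans[OF mid coherent_tens[OF ge2(2) coherent_refl]] show ?case by simp
  qed
  then show ?thesis by (simp add: shuffle_def coherent_def)
qed

lemma unit_shuffle_exists: "\<exists>f. unit_shuffle C n f"
proof -
  have "coherent (\<lambda>_ :: unit. \<I>) WUnit (wprod (\<lambda>_. WUnit) n)"
  proof (induction n rule: induct_nat_012)
    case (ge2 n)
    from coherent_trans[OF ge2(2) coherent_runit_inv[of "\<lambda>_. \<I>", OF unit_obj]]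
    show ?case by simp
  qed (simp_all add: coherent_refl)
  then show ?thesis by (simp add: unit_shuffle_def coherent_def)
qed

end


section \<open>Supply\<close>

text \<open>By Mac Lane's coherence theorem each of the predicates \<^const>\<open>rebracketing\<close>,
  \<^const>\<open>shuffle\<close> and \<^const>\<open>unit_shuffle\<close> holds of exactly one arrow, so quantifying over
  all shuffles \<open>\<sigma>\<close>, \<open>\<sigma>'\<close> is the same as speaking of the canonical ones.\<close>

locale prop_supply =
  P: prop_category P + C: symmetric_monoidal_category C
  for P :: "(nat, 'p, 'x) smcat_scheme" and C :: "('o, 'a, 'y) smcat_scheme"
    and s :: "'o \<Rightarrow> (nat, 'p, 'o, 'a) smfunctor" +
  assumes strong_monoidal: "c \<in> Obj C \<Longrightarrow> strong_monoidal_functor P C (s c)"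
    and supply_obj: "c \<in> Obj C \<Longrightarrow> FObj (s c) m = tpow C c m"
    and supply_strongator: "c \<in> Obj C \<Longrightarrow> rebracketing C c m n f \<longleftrightarrow> f = Strongator (s c) m n"
    and supply_tens: "\<lbrakk>c \<in> Obj C; d \<in> Obj C; \<mu> \<in> hom P m n; shuffle C c d m \<sigma>; shuffle C c d n \<sigma>'\<rbrakk> \<Longrightarrow>
      FArr (s (c \<otimes>\<^bsub>C\<^esub> d)) \<mu> \<odot>\<^bsub>C\<^esub> \<sigma> = \<sigma>' \<odot>\<^bsub>C\<^esub> (FArr (s c) \<mu> \<boxtimes>\<^bsub>C\<^esub> FArr (s d) \<mu>)"
    and supply_unit: "\<lbrakk>\<mu> \<in> hom P m n; unit_shuffle C m \<sigma>; unit_shuffle C n \<sigma>'\<rbrakk> \<Longrightarrow>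
      FArr (s \<I>\<^bsub>C\<^esub>) \<mu> \<odot>\<^bsub>C\<^esub> \<sigma> = \<sigma>'"

definition supplies :: "('o, 'a, 'y) smcat_scheme \<Rightarrow> (nat, 'p, 'x) smcat_scheme \<Rightarrow> bool" where
  "supplies C P \<longleftrightarrow> (\<exists>s. prop_supply P C s)"

end

theory Submission
  imports Defs
begin

text \<open>The supply of \<open>C \<oplus> D\<close> is formed componentwise.  Each projection sends a coherence
  isomorphism of \<open>C \<oplus> D\<close> to one of the factor with the same underlying formal composite, so the
  conditions on shuffles follow from those in \<open>C\<close> and \<open>D\<close>.  That a pair of rebracketings is
  conversely a rebracketing needs no converse for coherence isomorphisms: a rebracketing exists
  in \<open>C \<oplus> D\<close>, and its projections are the unique rebracketings of the factors.\<close>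

text \<open>The operations are evaluated on explicit pairs only, so these rules fire once variables
  for objects and arrows are split; hence \<open>split_paired_all\<close> and the case splits in
  later proofs.\<close>

lemma biproduct_simps [simp]:
  "Obj (C \<oplus> D) = Obj C \<times> Obj D"
  "Arr (C \<oplus> D) = Arr C \<times> Arr D"
  "Dom (C \<oplus> D) (f, g) = (Dom C f, Dom D g)"
  "Cod (C \<oplus> D) (f, g) = (Cod C f, Cod D g)"
  "\<one>\<^bsub>C \<oplus> D\<^esub> (x, y) = (\<one>\<^bsub>C\<^esub> x, \<one>\<^bsub>D\<^esub> y)"
  "(f', g') \<odot>\<^bsub>C \<oplus> D\<^esub> (f, g) = (f' \<odot>\<^bsub>C\<^esub> f, g' \<odot>\<^bsub>D\<^esub> g)"
  "\<I>\<^bsub>C \<oplus> D\<^esub> = (\<I>\<^bsub>C\<^esub>, \<I>\<^bsub>D\<^esub>)"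
  "(x, y) \<otimes>\<^bsub>C \<oplus> D\<^esub> (x', y') = (x \<otimes>\<^bsub>C\<^esub> x', y \<otimes>\<^bsub>D\<^esub> y')"
  "(f, g) \<boxtimes>\<^bsub>C \<oplus> D\<^esub> (f', g') = (f \<boxtimes>\<^bsub>C\<^esub> f', g \<boxtimes>\<^bsub>D\<^esub> g')"
  "\<alpha>\<^bsub>C \<oplus> D\<^esub> (x, y) (x', y') (x'', y'') = (\<alpha>\<^bsub>C\<^esub> x x' x'', \<alpha>\<^bsub>D\<^esub> y y' y'')"
  "\<ll>\<^bsub>C \<oplus> D\<^esub> (x, y) = (\<ll>\<^bsub>C\<^esub> x, \<ll>\<^bsub>D\<^esub> y)"
  "\<rr>\<^bsub>C \<oplus> D\<^esub> (x, y) = (\<rr>\<^bsub>C\<^esub> x, \<rr>\<^bsub>D\<^esub> y)"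
  "\<beta>\<^bsub>C \<oplus> D\<^esub> (x, y) (x', y') = (\<beta>\<^bsub>C\<^esub> x x', \<beta>\<^bsub>D\<^esub> y y')"
  by (simp_all add: biproduct_def)

lemma hom_biproduct [simp]: "hom (C \<oplus> D) (x, y) (x', y') = hom C x x' \<times> hom D y y'"
  by (auto simp: hom_def)

lemma inverse_arrows_biproduct [simp]:
  "inverse_arrows (C \<oplus> D) (f, g) (f', g') \<longleftrightarrow> inverse_arrows C f f' \<and> inverse_arrows D g g'"
  by (auto simp: inverse_arrows_def)

lemma isos_biproduct [simp]: "isos (C \<oplus> D) (x, y) (x', y') = isos C x x' \<times> isos D y y'"
  by (auto simp: isos_def)

lemma category_biproduct:
  assumes "category C" "category D"
  shows "category (C \<oplus> D)"
proof -
  interpret C: category C by fact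
  interpret D: category D by fact
  show ?thesis
    by (unfold_locales; simp only: split_paired_all)
       (auto intro: C.dom_obj D.dom_obj C.cod_obj D.cod_obj C.id_hom D.id_hom C.comp_hom D.comp_hom
         C.id_left D.id_left C.id_right D.id_right C.comp_assoc D.comp_assoc)
qed

lemma symmetric_monoidal_category_biproduct:
  assumes "symmetric_monoidal_category C" "symmetric_monoidal_category D"
  shows "symmetric_monoidal_category (C \<oplus> D)"
proof -
  interpret C: symmetric_monoidal_category C by fact
  interpret D: symmetric_monoidal_category D by fact
  \<comment> \<open>With the category axioms in place, \<open>unfold_locales\<close> leaves only the
    monoidal ones.\<close>
  interpret category "C \<oplus> D"
    by (rule category_biproduct) unfold_locales
  show ?thesis
    by (unfold_locales; (simp only: split_paired_all biproduct_simps)?)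
       (auto simp: C.unit_obj D.unit_obj
         intro: C.tens_obj D.tens_obj C.tens_hom D.tens_hom
         C.tens_id D.tens_id C.tens_comp D.tens_comp C.assoc_iso D.assoc_iso
         C.lunit_iso D.lunit_iso C.runit_iso D.runit_iso C.braid_iso D.braid_iso
         C.assoc_natural D.assoc_natural C.lunit_natural D.lunit_natural
         C.runit_natural D.runit_natural C.braid_natural D.braid_natural
         C.pentagon D.pentagon C.triangle D.triangle C.hexagon D.hexagon C.symmetry D.symmetry)
qed

text \<open>The functor into a product category induced by two functors out of the same category:
  the diagonal followed by their product. The supply at \<open>(c, d)\<close> has this form.\<close>

definition pair_functor ::
    "('o, 'a, 'o1, 'a1) smfunctor \<Rightarrow> ('o, 'a, 'o2, 'a2) smfunctor \<Rightarrow>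
     ('o, 'a, 'o1 \<times> 'o2, 'a1 \<times> 'a2) smfunctor" where
  "pair_functor F G = \<lparr>
     FObj = (\<lambda>x. (FObj F x, FObj G x)),
     FArr = (\<lambda>f. (FArr F f, FArr G f)),
     Strongator = (\<lambda>x y. (Strongator F x y, Strongator G x y)),
     UnitStrongator = (UnitStrongator F, UnitStrongator G) \<rparr>"

lemma pair_functor_simps [simp]:
  "FObj (pair_functor F G) x = (FObj F x, FObj G x)"
  "FArr (pair_functor F G) f = (FArr F f, FArr G f)"
  "Strongator (pair_functor F G) x y = (Strongator F x y, Strongator G x y)"
  "UnitStrongator (pair_functor F G) = (UnitStrongator F, UnitStrongator G)"
  by (simp_all add: pair_functor_def)

lemma strong_monoidal_functor_pair:
  assumes "strong_monoidal_functor B C F" "strong_monoidal_functor B D G"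
  shows "strong_monoidal_functor B (C \<oplus> D) (pair_functor F G)"
proof -
  interpret F: strong_monoidal_functor B C F by fact
  interpret G: strong_monoidal_functor B D G by fact
  interpret CD: symmetric_monoidal_category "C \<oplus> D"
    by (rule symmetric_monoidal_category_biproduct) unfold_locales
  show ?thesis
    by unfold_locales
       (auto intro: F.map_obj G.map_obj F.map_hom G.map_hom F.map_id G.map_id F.map_comp G.map_comp
         F.strongator_iso G.strongator_iso F.unit_strongator_iso G.unit_strongator_iso
         F.strongator_natural G.strongator_natural F.strongator_assoc G.strongator_assoc
         F.strongator_lunit G.strongator_lunit F.strongator_runit G.strongator_runit
         F.strongator_braid G.strongator_braid)
qed

lemma tpow_biproduct: "tpow (C \<oplus> D) (c, d) n = (tpow C c n, tpow D d n)"
  unfolding tpow_def by (induction n rule: induct_nat_012) simp_all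

lemma weval_biproduct:
  "weval (C \<oplus> D) \<theta> u = (weval C (fst \<circ> \<theta>) u, weval D (snd \<circ> \<theta>) u)"
  by (induction u) simp_all

text \<open>Each generator in \<open>C \<oplus> D\<close> is a pair of generators, and composition,
  tensor and inverses are componentwise. The converse can fail: if a variable is repeated, the
  components may realize different permutations.\<close>

lemma coherence_iso_biproductD:
  assumes "coherence_iso (C \<oplus> D) \<theta> u w h"
  shows "coherence_iso C (fst \<circ> \<theta>) u w (fst h) \<and> coherence_iso D (snd \<circ> \<theta>) u w (snd h)"
  using assms
proof (induction rule: coherence_iso.induct)
  case (comp u v f w g)
  then show ?case by (cases f; cases g) (auto intro: coherence_iso.comp)
next
  case (tens u v f u' v' f')
  then show ?case by (cases f; cases f') (auto intro: coherence_iso.tens)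
next
  case (inv u v f g)
  then show ?case by (cases f; cases g) (auto intro: coherence_iso.inv)
qed (simp_all only: weval_biproduct biproduct_simps fst_conv snd_conv simp_thms
      coherence_iso.ident coherence_iso.assoc coherence_iso.lunit coherence_iso.runit
      coherence_iso.braid)

text \<open>The words stay the same, and the constant assignment with value \<open>(c, d)\<close>
  projects to the constant assignments with values \<open>c\<close> and \<open>d\<close>.\<close>

lemma rebracketing_biproductD:
  assumes "rebracketing (C \<oplus> D) (c, d) m n (f, g)"
  shows "rebracketing C c m n f" "rebracketing D d m n g"
  using coherence_iso_biproductD[OF assms[unfolded rebracketing_def]]
  by (simp_all add: rebracketing_def comp_def)

lemma shuffle_biproductD:
  assumes "shuffle (C \<oplus> D) (c, d) (c', d') n (f, g)"
  shows "shuffle C c c' n f" "shuffle D d d' n g"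
  \<comment> \<open>\<open>o_case_sum\<close> moves the projection into both branches of the
    assignment, which yields the assignments for shuffles in the factors.\<close>
  using coherence_iso_biproductD[OF assms[unfolded shuffle_def], unfolded o_case_sum]
  by (simp_all add: shuffle_def comp_def)

lemma unit_shuffle_biproductD:
  assumes "unit_shuffle (C \<oplus> D) n (f, g)"
  shows "unit_shuffle C n f" "unit_shuffle D n g"
  using coherence_iso_biproductD[OF assms[unfolded unit_shuffle_def]]
  by (simp_all add: unit_shuffle_def comp_def)

text \<open>The tensor and unit conditions take shuffles of \<open>C \<oplus> D\<close> as
  hypotheses, so projecting these suffices. Only the strongator condition also asserts that an arrow
  is a rebracketing.\<close>

lemma prop_supply_biproduct:
  assumes "prop_supply P C s" "prop_supply P D t"
  shows "prop_supply P (C \<oplus> D) (\<lambda>(c, d). pair_functor (s c) (t d))"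
proof -
  interpret S: prop_supply P C s by fact
  interpret T: prop_supply P D t by fact
  interpret CD: symmetric_monoidal_category "C \<oplus> D"
    by (rule symmetric_monoidal_category_biproduct) unfold_locales
  have strongator: "rebracketing (C \<oplus> D) (c, d) m n h \<longleftrightarrow>
      h = (Strongator (s c) m n, Strongator (t d) m n)"
    if "c \<in> Obj C" "d \<in> Obj D" for c d m n h
  proof -
    \<comment> \<open>Uniqueness in the factors is part of the two given supplies, so the coherence
      theorem is not invoked.\<close>
    have unique: "h = (Strongator (s c) m n, Strongator (t d) m n)"
      if "rebracketing (C \<oplus> D) (c, d) m n h" for h
      using that S.supply_strongator[OF \<open>c \<in> Obj C\<close>] T.supply_strongator[OF \<open>d \<in> Obj D\<close>]
      by (cases h) (auto dest: rebracketing_biproductD)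
    \<comment> \<open>By \<open>unique\<close>, this \<open>h'\<close> is the pair of strongators,
      so that pair is itself a rebracketing.\<close>
    moreover obtain h' where "rebracketing (C \<oplus> D) (c, d) m n h'"
      using CD.rebracketing_exists \<open>c \<in> Obj C\<close> \<open>d \<in> Obj D\<close> by force
    ultimately show ?thesis by blast
  qed
  show ?thesis
  proof (intro prop_supply.intro prop_supply_axioms.intro S.P.prop_category_axioms
      CD.symmetric_monoidal_category_axioms, goal_cases)
    case (1 cd)
    then show ?case
      by (cases cd) (auto intro: strong_monoidal_functor_pair S.strong_monoidal T.strong_monoidal)
  next
    case (2 cd m)
    then show ?case
      by (cases cd) (simp add: tpow_biproduct S.supply_obj T.supply_obj)
  next
    case (3 cd m n f)
    then show ?case
      by (cases cd) (simp add: strongator)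
  next
    case (4 cd cd' \<mu> m n \<sigma> \<sigma>')
    obtain c d c' d' f g f' g'
      where eq: "cd = (c, d)" "cd' = (c', d')" "\<sigma> = (f, g)" "\<sigma>' = (f', g')"
      by (cases cd, cases cd', cases \<sigma>, cases \<sigma>')
    \<comment> \<open>The first two facts concern \<open>f\<close> and \<open>f'\<close> in
      \<open>C\<close>, the last two \<open>g\<close> and \<open>g'\<close> in
      \<open>D\<close>.\<close>
    note shuffles = 4(4,5)[unfolded eq, THEN shuffle_biproductD(1)]
      4(4,5)[unfolded eq, THEN shuffle_biproductD(2)]
    from 4(1,2) show ?case
      using S.supply_tens[OF _ _ 4(3) shuffles(1,2)] T.supply_tens[OF _ _ 4(3) shuffles(3,4)]
      by (simp add: eq)
  next
    case (5 \<mu> m n \<sigma> \<sigma>')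
    obtain f g f' g' where eq: "\<sigma> = (f, g)" "\<sigma>' = (f', g')"
      by (cases \<sigma>, cases \<sigma>')
    note shuffles = 5(2,3)[unfolded eq, THEN unit_shuffle_biproductD(1)]
      5(2,3)[unfolded eq, THEN unit_shuffle_biproductD(2)]
    show ?case
      using S.supply_unit[OF 5(1) shuffles(1,2)] T.supply_unit[OF 5(1) shuffles(3,4)]
      by (simp add: eq)
  qed
qed

theorem proposition3p23:
  fixes P :: "(nat, 'p) smcat"
    and C :: "('o1, 'a1) smcat"
    and D :: "('o2, 'a2) smcat"
  assumes "prop_category P"
    and "symmetric_monoidal_category C"
    and "symmetric_monoidal_category D"
    and "supplies C P"
    and "supplies D P"
  shows "supplies (C \<oplus> D) P"
  using assms(4,5) prop_supply_biproduct unfolding supplies_def by blast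

end
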